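(* Let $q>2$ and $n\ge1$ be integers with $n\equiv q \pmod{q^2}$, and let $\lambda$ be a positive integer. Then every $\lambda$-fold $1$-packing $C$ in $H(n,q)$ satisfies $$|C| \le \frac{q^n((n+1)\lambda-1)}{n^2(q-1)+nq}.$$ Moreover, if $q$, $n$, and $\lambda$ are all even, then $$|C| \le \frac{q^n((n+1)(q-1)\lambda-q)}{n(q-1)(n(q-1)+q)}.$$ In each case, if equality holds in the bound, then $C$ has no multiple codewords.
   Context: $H(n,q)$ is the Hamming graph on words of length $n$ over $\{0,1,\ldots,q-1\}$, two words adjacent iff they differ in exactly one position. A $\lambda$-fold $1$-packing is a multiset $C$ of vertices such that every vertex of $H(n,q)$ is at Hamming distance at most $1$ from at most $\lambda$ elements of $C$, counted with multiplicity; $|C|$ is the size counted with multiplicity. *)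

theory Defs
  imports Complex_Main "HOL-Library.Multiset" "HOL-Number_Theory.Cong"
begin

definition hamming_vertices :: "nat \<Rightarrow> nat \<Rightarrow> nat list set" where
  "hamming_vertices n q = {w. length w = n \<and> set w \<subseteq> {0..<q}}"

(* Only meaningful for lists of equal length; it is applied to vertices of one Hamming graph only. *)
definition hamming_dist :: "nat list \<Rightarrow> nat list \<Rightarrow> nat" where
  "hamming_dist v w = card {i. i < length v \<and> v ! i \<noteq> w ! i}"

(* Filtering a multiset keeps multiplicities, so the size below counts with multiplicity. *)
definition fold_one_packing :: "nat \<Rightarrow> nat \<Rightarrow> nat \<Rightarrow> nat list multiset \<Rightarrow> bool" where
  "fold_one_packing l n q C \<longleftrightarrow>
     set_mset C \<subseteq> hamming_vertices n q \<and>
     (\<forall>v \<in> hamming_vertices n q. size {# c \<in># C. hamming_dist v c \<le> 1 #} \<le> l)"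

definition no_multiple_codewords :: "nat list multiset \<Rightarrow> bool" where
  "no_multiple_codewords C \<longleftrightarrow> (\<forall>c \<in># C. count C c = 1)"

end

theory Submission imports Defs begin

text \<open>Let \<open>f\<close> be the multiplicity function of \<open>C\<close>, \<open>A\<close> the adjacency operator,
  \<open>m = n (q - 1)\<close>, and let \<open>g = l - f - A f \<ge> 0\<close> be the slack of the packing condition. As \<open>q\<close>
  divides \<open>n\<close>, all eigenvalues of \<open>A\<close> are multiples of \<open>q\<close>, so \<open>A (A + q)\<close> is positive
  semidefinite, and comparing with the constant component of \<open>f\<close> yields
  \<open>\<langle>f, A (A + q) f\<rangle> \<ge> m (m + q) |C|\<^sup>2 / q\<^sup>n\<close>.
  On the other hand \<open>A (A + q) f = l (n + 1) (q - 1) - (q - 1) f - (q - 1) g - A g\<close>, where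
  \<open>\<langle>f, f\<rangle> \<ge> |C|\<close> because \<open>f\<close> is integral; this is the first bound. If \<open>q\<close>, \<open>n\<close>, \<open>l\<close> are even,
  then \<open>f + g + A g\<close> is even, so \<open>(q - 1) g + A g \<ge> 1\<close> wherever \<open>f = 1\<close>, which gives the second
  one. Both estimates are strict where \<open>f \<ge> 2\<close>.\<close>

section \<open>The line-sum operator and its linearity\<close>

text \<open>As an operator, \<open>line_sum q\<close> is \<open>A + n\<close> on words of length \<open>n\<close>: it sums \<open>f\<close> over all \<open>n\<close> lines
  through a word, each containing the word itself.\<close>

primrec line_sum :: "nat \<Rightarrow> (nat list \<Rightarrow> 'a::comm_ring_1) \<Rightarrow> nat list \<Rightarrow> 'a" where
  "line_sum q f [] = 0"
| "line_sum q f (x # w) = (\<Sum>a<q. f (a # w)) + line_sum q (\<lambda>u. f (x # u)) w"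

lemma line_sum_add: "line_sum q (\<lambda>v. f v + g v) v = line_sum q f v + line_sum q g v"
  by (induction v arbitrary: f g) (simp_all add: sum.distrib algebra_simps)

lemma line_sum_scale: "line_sum q (\<lambda>v. c * f v) v = c * line_sum q f v"
  by (induction v arbitrary: f) (simp_all add: sum_distrib_left algebra_simps)

lemma line_sum_diff: "line_sum q (\<lambda>v. f v - g v) v = line_sum q f v - line_sum q g v"
  by (induction v arbitrary: f g) (simp_all add: sum_subtractf algebra_simps)

lemma line_sum_const: "line_sum q (\<lambda>v. c) v = of_nat (length v) * of_nat q * c"
  by (induction v) (simp_all add: algebra_simps)

lemma line_sum_sum: "line_sum q (\<lambda>v. \<Sum>a\<in>S. f a v) v = (\<Sum>a\<in>S. line_sum q (f a) v)"
proof (induction v arbitrary: f)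
  case (Cons x v)
  then show ?case
    by (simp add: sum.distrib sum.swap[of _ S])
qed simp

lemma line_sum_of_int: "line_sum q (\<lambda>v. of_int (f v)) v = of_int (line_sum q f v)"
  by (induction v arbitrary: f) simp_all

section \<open>Vertices by first letter; order, symmetry and parity of the line sum\<close>

lemma hamming_vertices_0: "hamming_vertices 0 q = {[]}"
  by (auto simp: hamming_vertices_def)

lemma Cons_in_hamming_vertices:
  "a # w \<in> hamming_vertices (Suc n) q \<longleftrightarrow> a < q \<and> w \<in> hamming_vertices n q"
  by (auto simp: hamming_vertices_def)

lemma hamming_vertices_Suc:
  "hamming_vertices (Suc n) q = (\<lambda>(a, w). a # w) ` ({..<q} \<times> hamming_vertices n q)"
proof -
  have "v \<in> (\<lambda>(a, w). a # w) ` ({..<q} \<times> hamming_vertices n q)"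
    if "v \<in> hamming_vertices (Suc n) q" for v
    using that by (cases v) (auto simp: hamming_vertices_def)
  then show ?thesis
    by (auto simp: Cons_in_hamming_vertices)
qed

lemma finite_hamming_vertices [simp]: "finite (hamming_vertices n q)"
  by (induction n) (simp_all add: hamming_vertices_0 hamming_vertices_Suc)

lemma sum_hamming_vertices_Suc:
  "sum f (hamming_vertices (Suc n) q) = (\<Sum>a<q. \<Sum>w\<in>hamming_vertices n q. f (a # w))"
proof -
  have "inj_on (\<lambda>(a, w). a # w) ({..<q} \<times> hamming_vertices n q)"
    by (auto simp: inj_on_def)
  then show ?thesis
    unfolding hamming_vertices_Suc by (subst sum.reindex) (simp_all add: sum.cartesian_product split_def)
qed

text \<open>Each of the \<open>n\<close> lines through \<open>v\<close> contains \<open>v\<close>,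
  so \<open>f v\<close> is counted \<open>n\<close> times. Hence \<open>A\<close> preserves
  nonnegativity.\<close>

lemma line_sum_nonneg_ge:
  fixes f :: "nat list \<Rightarrow> int"
  assumes "v \<in> hamming_vertices n q" and "\<And>w. w \<in> hamming_vertices n q \<Longrightarrow> f w \<ge> 0"
  shows "int n * f v \<le> line_sum q f v"
  using assms
proof (induction n arbitrary: v f)
  case 0
  then show ?case by (simp add: hamming_vertices_0)
next
  case (Suc n)
  then obtain x w where v: "v = x # w" "x < q" "w \<in> hamming_vertices n q"
    by (auto simp: hamming_vertices_Suc)
  have "int n * f (x # w) \<le> line_sum q (\<lambda>u. f (x # u)) w"
    using Suc.IH[OF v(3), of "\<lambda>u. f (x # u)"] Suc.prems(2) v(2)
    by (simp add: Cons_in_hamming_vertices)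
  moreover have "f (x # w) \<le> (\<Sum>a<q. f (a # w))"
    by (rule member_le_sum) (use v Suc.prems(2) in \<open>auto simp: Cons_in_hamming_vertices\<close>)
  ultimately show ?case
    by (simp add: v(1) algebra_simps)
qed

text \<open>In the first direction both sides add up, over all lines, the sum of \<open>f\<close>
  times the sum of \<open>h\<close>; induction covers the other directions.\<close>

lemma line_sum_adjoint:
  "(\<Sum>v\<in>hamming_vertices n q. line_sum q f v * h v) = (\<Sum>v\<in>hamming_vertices n q. f v * line_sum q h v)"
proof (induction n arbitrary: f h)
  case 0
  then show ?case by (simp add: hamming_vertices_0)
next
  case (Suc n)
  let ?V = "hamming_vertices n q"
  have "(\<Sum>a<q. \<Sum>w\<in>?V. (\<Sum>b<q. f (b # w)) * h (a # w)) = (\<Sum>a<q. \<Sum>w\<in>?V. f (a # w) * (\<Sum>b<q. h (b # w)))"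
    unfolding sum.swap[of _ ?V] sum_distrib_left[symmetric] sum_distrib_right[symmetric] ..
  then show ?case
    by (simp add: sum_hamming_vertices_Suc distrib_left distrib_right sum.distrib Suc)
qed

text \<open>Write the line sum as \<open>S + T\<close>, with \<open>S\<close> summing over the first
  letter. \<open>S\<close> and \<open>T\<close> commute and \<open>S S = q S\<close>, so the square
  is \<open>q S + 2 S T + T T\<close>, and \<open>T T\<close> is even by induction.\<close>

lemma even_line_sum_twice:
  fixes f :: "nat list \<Rightarrow> int"
  assumes "even q"
  shows "even (line_sum q (line_sum q f) v)"
proof (induction v arbitrary: f)
  case (Cons x w)
  then show ?case
    using assms by (simp add: line_sum_add line_sum_sum sum.distrib)
qed simp

section \<open>Lower bound for the quadratic form\<close>

text \<open>In the inductive step the slices of \<open>f\<close> in the first direction are split into their mean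
  \<open>mu\<close>, which shifts \<open>k\<close> by one, and the deviations \<open>u\<close> from it, whose cross terms with
  \<open>mu\<close> cancel; the deviations contribute a nonnegative amount because a product of two
  consecutive integers is nonnegative.\<close>

lemma line_sum_form_lower:
  fixes f :: "nat list \<Rightarrow> real" and k :: int
  assumes "q > 0"
  shows "real q ^ 2 * of_int ((int n - k) * (int n - k + 1)) * (\<Sum>v\<in>hamming_vertices n q. f v) ^ 2
    \<le> real q ^ n * (\<Sum>v\<in>hamming_vertices n q.
        (line_sum q f v - q * of_int k * f v) * (line_sum q f v - q * of_int k * f v + q * f v))"
proof (induction n arbitrary: f k)
  case 0
  then show ?case by (simp add: hamming_vertices_0 power2_eq_square algebra_simps)
next
  case (Suc n)
  let ?V = "hamming_vertices n q"
  define Q :: "int \<Rightarrow> (nat list \<Rightarrow> real) \<Rightarrow> nat list \<Rightarrow> real" where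
    "Q = (\<lambda>k f v. (line_sum q f v - real q * of_int k * f v) * (line_sum q f v - real q * of_int k * f v + real q * f v))"
  define mu where "mu w = (\<Sum>a<q. f (a # w)) / real q" for w
  define u where "u a w = f (a # w) - mu w" for a w
  have f: "f (a # w) = u a w + mu w" for a w
    by (simp add: u_def)
  have su: "(\<Sum>a<q. u a w) = 0" for w
    using assms by (simp add: u_def mu_def sum_subtractf)
  have sLu: "(\<Sum>a<q. line_sum q (u a) w) = 0" for w
    by (simp add: line_sum_sum[symmetric] su line_sum_const)
  have split: "(\<Sum>a<q. Q k f (a # w)) = (\<Sum>a<q. Q k (u a) w) + q * Q (k - 1) mu w" for w
  proof -
    define M where "M = line_sum q mu w"
    have L: "line_sum q f (a # w) = q * mu w + (line_sum q (u a) w + M)" for a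
      using assms by (simp add: f line_sum_add sum.distrib su M_def)
    \<comment> \<open>\<open>B\<close> is the first factor of \<open>Q (k - 1) mu w\<close>: the
      term \<open>q * mu w\<close> in \<open>L\<close> turns \<open>k\<close> into
      \<open>k - 1\<close>. The cross terms are linear in \<open>u a w\<close> and its line sum,
      with coefficients free of \<open>a\<close>, so they vanish on summing over
      \<open>a\<close>.\<close>
    define B where "B = M - real q * (of_int k - 1) * mu w"
    have "Q k f (a # w) = Q k (u a) w + Q (k - 1) mu w
        + line_sum q (u a) w * (2 * B + real q * mu w)
        + u a w * (real q * B - real q * of_int k * (2 * B + real q * mu w))" for a
    proof -
      have *: "(q' * m + (t + M) - q' * k' * (x + m)) * (q' * m + (t + M) - q' * k' * (x + m) + q' * (x + m))
        = (t - q' * k' * x) * (t - q' * k' * x + q' * x)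
          + (M - q' * (k' - 1) * m) * (M - q' * (k' - 1) * m + q' * m)
          + t * (2 * (M - q' * (k' - 1) * m) + q' * m)
          + x * (q' * (M - q' * (k' - 1) * m) - q' * k' * (2 * (M - q' * (k' - 1) * m) + q' * m))"
        for q' m t M k' x :: real
        by algebra
      show ?thesis
        unfolding Q_def L B_def unfolding f M_def[symmetric] of_int_diff of_int_1 by (rule *)
    qed
    then show ?thesis
      by (simp add: sum.distrib sum_distrib_right[symmetric] su sLu)
  qed
  have cons: "(int n - k) * (int n - k + 1) \<ge> 0"
    by (cases "int n - k \<ge> 0") (auto intro: mult_nonneg_nonneg mult_nonpos_nonpos)
  have dev: "(\<Sum>w\<in>?V. Q k (u a) w) \<ge> 0" for a
  proof -
    have "0 \<le> real q ^ n * (\<Sum>w\<in>?V. Q k (u a) w)"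
      using Suc[of k "u a"] cons unfolding Q_def
      by (smt (verit) mult_nonneg_nonneg of_int_0_le_iff zero_le_power2)
    moreover have "real q ^ n > 0"
      using assms by simp
    ultimately show ?thesis
      by (simp add: zero_le_mult_iff)
  qed
  have tot: "sum f (hamming_vertices (Suc n) q) = q * sum mu ?V"
    using assms unfolding sum_hamming_vertices_Suc sum.swap[of _ ?V] sum_distrib_left
    by (simp add: mu_def)
  have "real q ^ 2 * of_int ((int (Suc n) - k) * (int (Suc n) - k + 1)) * (q * sum mu ?V) ^ 2
      = q * q * (real q ^ 2 * of_int ((int n - (k - 1)) * (int n - (k - 1) + 1)) * (sum mu ?V) ^ 2)"
    by (simp add: power2_eq_square algebra_simps)
  also have "\<dots> \<le> q * q * (real q ^ n * (\<Sum>w\<in>?V. Q (k - 1) mu w))"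
    using Suc[of "k - 1" mu] unfolding Q_def by (intro mult_left_mono) auto
  also have "\<dots> \<le> real q ^ Suc n * (\<Sum>a<q. \<Sum>w\<in>?V. Q k f (a # w))"
  proof -
    have "(\<Sum>a<q. \<Sum>w\<in>?V. Q k f (a # w))
        = (\<Sum>a<q. \<Sum>w\<in>?V. Q k (u a) w) + q * (\<Sum>w\<in>?V. Q (k - 1) mu w)"
      by (simp add: sum.swap[of _ ?V] split sum.distrib sum_distrib_left)
    moreover have "(\<Sum>a<q. \<Sum>w\<in>?V. Q k (u a) w) \<ge> 0"
      by (intro sum_nonneg dev)
    ultimately show ?thesis
      by (simp add: algebra_simps)
  qed
  finally show ?case
    unfolding tot by (simp add: sum_hamming_vertices_Suc Q_def)
qed

section \<open>Balls of radius one\<close>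

lemma hamming_dist_Cons:
  "hamming_dist (x # v) (y # w) = (if x = y then 0 else 1) + hamming_dist v w"
proof -
  have "{i. i < length (x # v) \<and> (x # v) ! i \<noteq> (y # w) ! i}
      = (if x = y then {} else {0}) \<union> Suc ` {i. i < length v \<and> v ! i \<noteq> w ! i}" (is "?L = ?R")
  proof (intro set_eqI)
    show "i \<in> ?L \<longleftrightarrow> i \<in> ?R" for i
      by (cases i) auto
  qed
  then show ?thesis
    by (simp add: hamming_dist_def card_image card_insert_if image_iff)
qed

lemma hamming_dist_eq_0_iff: "length v = length w \<Longrightarrow> hamming_dist v w = 0 \<longleftrightarrow> v = w"
  by (auto simp: hamming_dist_def intro: nth_equalityI)

text \<open>The line sum counts the centre \<open>n\<close> times, the ball once. By first letter,
  the ball around \<open>x # u\<close> is \<open>x\<close> prefixed to the ball around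
  \<open>u\<close>, together with all \<open>a # u\<close> for \<open>a\<close> other than
  \<open>x\<close>.\<close>

lemma sum_ball_eq_line_sum:
  fixes f :: "nat list \<Rightarrow> 'a::comm_ring_1"
  assumes "v \<in> hamming_vertices n q"
  shows "(\<Sum>w | w \<in> hamming_vertices n q \<and> hamming_dist v w \<le> 1. f w)
    = line_sum q f v - (of_nat n - 1) * f v"
  using assms
proof (induction n arbitrary: v f)
  case 0
  have "{w. w = [] \<and> hamming_dist [] w \<le> 1} = {[]}"
    by (auto simp: hamming_dist_def)
  with 0 show ?case by (simp add: hamming_vertices_0)
next
  case (Suc n)
  let ?V = "hamming_vertices n q"
  obtain x u where v: "v = x # u" "x < q" "u \<in> ?V"
    using Suc.prems by (auto simp: hamming_vertices_Suc)
  have "{w. w \<in> hamming_vertices (Suc n) q \<and> hamming_dist v w \<le> 1}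
      = Cons x ` {w \<in> ?V. hamming_dist u w \<le> 1} \<union> (\<lambda>a. a # u) ` ({..<q} - {x})"
    (is "?L = ?R")
  proof (intro set_eqI)
    fix w
    show "w \<in> ?L \<longleftrightarrow> w \<in> ?R"
    proof (cases w)
      case Nil
      then show ?thesis by (auto simp: hamming_vertices_def)
    next
      case (Cons y t)
      have "hamming_dist u t = 0 \<longleftrightarrow> t = u" if "t \<in> ?V"
        using that v(3) hamming_dist_eq_0_iff[of u t] by (auto simp: hamming_vertices_def)
      then show ?thesis
        using v Cons by (auto simp: Cons_in_hamming_vertices hamming_dist_Cons)
    qed
  qed
  moreover have "Cons x ` {w \<in> ?V. hamming_dist u w \<le> 1} \<inter> (\<lambda>a. a # u) ` ({..<q} - {x}) = {}"
    by auto
  ultimately have "(\<Sum>w | w \<in> hamming_vertices (Suc n) q \<and> hamming_dist v w \<le> 1. f w)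
      = (\<Sum>w | w \<in> ?V \<and> hamming_dist u w \<le> 1. f (x # w)) + (\<Sum>a\<in>{..<q} - {x}. f (a # u))"
    by (simp add: sum.union_disjoint sum.reindex inj_on_def)
  also have "\<dots> = line_sum q (\<lambda>w. f (x # w)) u - (of_nat n - 1) * f (x # u)
      + ((\<Sum>a<q. f (a # u)) - f (x # u))"
    using v Suc.IH[OF v(3), of "\<lambda>w. f (x # w)"] by (simp add: sum_diff1)
  finally show ?case
    by (simp add: v(1) algebra_simps)
qed

lemma size_filter_mset_eq_sum:
  assumes "set_mset C \<subseteq> S" and "finite S"
  shows "size {# c \<in># C. P c #} = (\<Sum>c | c \<in> S \<and> P c. count C c)"
proof -
  have "size {# c \<in># C. P c #} = (\<Sum>c\<in>set_mset {# c \<in># C. P c #}. count C c)"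
    unfolding size_multiset_overloaded_eq by (intro sum.cong) auto
  also have "\<dots> = (\<Sum>c | c \<in> S \<and> P c. count C c)"
    by (rule sum.mono_neutral_left) (use assms in \<open>auto simp: count_eq_zero_iff\<close>)
  finally show ?thesis .
qed


section \<open>Slack and the weighted bound\<close>

definition slack :: "nat \<Rightarrow> nat \<Rightarrow> 'a::comm_ring_1 \<Rightarrow> (nat list \<Rightarrow> 'a) \<Rightarrow> nat list \<Rightarrow> 'a" where
  "slack n q l f v = l - line_sum q f v + (of_nat n - 1) * f v"

text \<open>This is \<open>A + q - 1\<close> applied to the slack, with \<open>A\<close> the line
  sum minus \<open>n\<close>.\<close>

definition slack_weight :: "nat \<Rightarrow> nat \<Rightarrow> 'a::comm_ring_1 \<Rightarrow> (nat list \<Rightarrow> 'a) \<Rightarrow> nat list \<Rightarrow> 'a" where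
  "slack_weight n q l f v = (of_nat q - 1) * slack n q l f v
     + (line_sum q (slack n q l f) v - of_nat n * slack n q l f v)"

lemma line_sum_slack:
  "line_sum q (slack n q l f) v = of_nat (length v) * of_nat q * l
     - line_sum q (line_sum q f) v + (of_nat n - 1) * line_sum q f v"
  unfolding slack_def by (simp add: line_sum_add line_sum_diff line_sum_scale line_sum_const)

text \<open>The left-hand side is \<open>\<langle>A f, (A + q) f\<rangle>\<close>; moving the first \<open>A\<close> to the right factor leaves a pointwise
  identity.\<close>

lemma adjacency_form_eq:
  fixes f :: "nat list \<Rightarrow> 'a::comm_ring_1"
  shows "(\<Sum>v\<in>hamming_vertices n q. (line_sum q f v - of_nat n * f v)
        * (line_sum q f v - of_nat n * f v + of_nat q * f v))
    = (\<Sum>v\<in>hamming_vertices n q. f v * (l * (of_nat q - 1) * (of_nat n + 1)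
        - (of_nat q - 1) * f v - slack_weight n q l f v))"
proof -
  define h where "h v = (line_sum q f v - of_nat n * f v) + of_nat q * f v" for v
  have "(\<Sum>v\<in>hamming_vertices n q. (line_sum q f v - of_nat n * f v) * h v)
      = (\<Sum>v\<in>hamming_vertices n q. line_sum q f v * h v) - (\<Sum>v\<in>hamming_vertices n q. of_nat n * f v * h v)"
    by (simp add: algebra_simps sum_subtractf)
  also have "\<dots> = (\<Sum>v\<in>hamming_vertices n q. f v * (line_sum q h v - of_nat n * h v))"
    by (subst line_sum_adjoint) (simp add: algebra_simps sum_subtractf)
  also have "\<dots> = (\<Sum>v\<in>hamming_vertices n q. f v * (l * (of_nat q - 1) * (of_nat n + 1)
        - (of_nat q - 1) * f v - slack_weight n q l f v))"
  proof (rule sum.cong[OF refl])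
    fix v assume "v \<in> hamming_vertices n q"
    then have len: "length v = n" by (simp add: hamming_vertices_def)
    \<comment> \<open>\<open>A (A + q) = (A + q - 1) (A + 1) - (q - 1)\<close>, and
      \<open>(A + 1) f\<close> is \<open>l\<close> minus the slack. On constants
      \<open>A + q - 1\<close> is multiplication by \<open>(q - 1) (n + 1)\<close>.\<close>
    have "line_sum q h v - of_nat n * h v = l * (of_nat q - 1) * (of_nat n + 1)
        - (of_nat q - 1) * f v - slack_weight n q l f v"
      unfolding slack_weight_def line_sum_slack len unfolding slack_def h_def
      by (simp add: line_sum_add line_sum_diff line_sum_scale) (simp add: algebra_simps)
    then show "f v * (line_sum q h v - of_nat n * h v) = f v * (l * (of_nat q - 1) * (of_nat n + 1)
        - (of_nat q - 1) * f v - slack_weight n q l f v)" by simp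
  qed
  finally show ?thesis by (simp add: h_def)
qed

text \<open>Let \<open>L\<close> be the line sum. Modulo 2, \<open>A\<close> is \<open>L\<close> and
  the slack is \<open>f + L f\<close>; as \<open>L L f\<close> is even, the total is
  \<open>f + (f + L f) + L f\<close>.\<close>

lemma even_slack_parity:
  fixes f :: "nat list \<Rightarrow> int"
  assumes "even q" "even n" "even l" "length v = n"
  shows "even (f v + slack n q l f v + (line_sum q (slack n q l f) v - int n * slack n q l f v))"
  unfolding line_sum_slack unfolding slack_def
  using assms even_line_sum_twice[OF assms(1), of f v] by auto

text \<open>The parameter \<open>c\<close> will be \<open>q - 1\<close> in general and
  \<open>q\<close> in the even case. Equality makes the pointwise estimate by \<open>c\<close> sharp
  at every vertex, which \<open>f v \<ge> 2\<close> excludes because \<open>(q - 1) * f v\<close>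
  then exceeds \<open>c\<close>.\<close>

lemma weighted_bound:
  fixes f :: "nat list \<Rightarrow> int" and c :: int
  assumes q: "q > 0" and dvd: "q dvd n"
    and f0: "\<And>v. v \<in> hamming_vertices n q \<Longrightarrow> f v \<ge> 0"
    and W: "\<And>v. v \<in> hamming_vertices n q \<Longrightarrow> slack_weight n q l f v \<ge> 0"
    and c: "\<And>v. v \<in> hamming_vertices n q \<Longrightarrow> f v > 0 \<Longrightarrow> c \<le> (int q - 1) * f v + slack_weight n q l f v"
    and F: "F = (\<Sum>v\<in>hamming_vertices n q. f v)"
  shows "int n * (int q - 1) * (int n * (int q - 1) + int q) * F ^ 2
      \<le> int q ^ n * (l * (int q - 1) * (int n + 1) - c) * F"
    and "\<lbrakk>int n * (int q - 1) * (int n * (int q - 1) + int q) * F ^ 2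
        = int q ^ n * (l * (int q - 1) * (int n + 1) - c) * F; c < 2 * (int q - 1); v \<in> hamming_vertices n q\<rbrakk> \<Longrightarrow> f v \<le> 1"
proof -
  let ?V = "hamming_vertices n q"
  let ?lhs = "int n * (int q - 1) * (int n * (int q - 1) + int q) * F ^ 2"
  let ?rhs = "int q ^ n * (l * (int q - 1) * (int n + 1) - c) * F"
  define D where "D = l * (int q - 1) * (int n + 1)"
  define X where "X v = f v * (D - (int q - 1) * f v - slack_weight n q l f v)" for v
  obtain k where k: "n = q * k" using dvd by blast
  \<comment> \<open>From \<open>n = q * k\<close> follows \<open>n (q - 1) = q (n - k)\<close>, so
    the coefficient is the one in \<open>line_sum_form_lower\<close> for this
    \<open>k\<close>.\<close>
  have "real_of_int ?lhs = real q ^ 2 * of_int ((int n - int k) * (int n - int k + 1)) * of_int F ^ 2"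
    unfolding k by (simp add: power2_eq_square algebra_simps)
  also have "\<dots> \<le> real q ^ n * (\<Sum>v\<in>?V. (line_sum q (\<lambda>v. real_of_int (f v)) v - real q * real k * of_int (f v))
      * (line_sum q (\<lambda>v. real_of_int (f v)) v - real q * real k * of_int (f v) + real q * of_int (f v)))"
    using line_sum_form_lower[OF q, where f = "\<lambda>v. real_of_int (f v)" and k = "int k" and n = n] unfolding F
    by simp
  also have "\<dots> = of_int (int q ^ n * (\<Sum>v\<in>?V. (line_sum q f v - int n * f v)
      * (line_sum q f v - int n * f v + int q * f v)))"
    unfolding line_sum_of_int by (simp add: k)
  also have "\<dots> = of_int (int q ^ n * sum X ?V)"
    unfolding X_def D_def by (subst adjacency_form_eq[where l = l]) simp
  finally have lhs: "?lhs \<le> int q ^ n * sum X ?V"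
    by linarith
  have X: "X v \<le> (D - c) * f v" if "v \<in> ?V" for v
  proof (cases "f v = 0")
    case False
    then have "f v > 0" using f0[OF that] by simp
    then have "f v * c \<le> f v * ((int q - 1) * f v + slack_weight n q l f v)"
      using c[OF that] by (intro mult_left_mono) auto
    then show ?thesis by (simp add: X_def algebra_simps)
  qed (simp add: X_def)
  have sumX: "sum X ?V \<le> (D - c) * F"
    unfolding F sum_distrib_left by (intro sum_mono X)
  then show le: "?lhs \<le> ?rhs"
    using lhs q by (smt (verit) D_def mult.assoc mult_left_mono of_nat_0_le_iff zero_le_power)
  assume eq: "?lhs = ?rhs" and c2: "c < 2 * (int q - 1)" and v: "v \<in> ?V"
  have "int q ^ n * ((D - c) * F) \<le> int q ^ n * sum X ?V"
    using lhs eq by (simp add: D_def mult.assoc)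
  then have "(D - c) * F \<le> sum X ?V"
    using q by simp
  with sumX have sum_eq: "sum X ?V = (\<Sum>v\<in>?V. (D - c) * f v)"
    unfolding F sum_distrib_left by simp
  have Xv: "X v = (D - c) * f v"
    by (rule sum_mono_inv[OF sum_eq X v finite_hamming_vertices])
  show "f v \<le> 1"
  proof (rule ccontr)
    assume "\<not> f v \<le> 1"
    then have f2: "f v \<ge> 2" by simp
    have "f v * (D - (int q - 1) * f v - slack_weight n q l f v) = f v * (D - c)"
      using Xv by (simp add: X_def mult.commute)
    then have "c = (int q - 1) * f v + slack_weight n q l f v"
      using f2 by simp
    moreover have "(int q - 1) * 2 \<le> (int q - 1) * f v"
      using f2 q by (intro mult_left_mono) auto
    ultimately show False
      using c2 W[OF v] by simp
  qed
qed

section \<open>Both bounds and their equality cases\<close>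

theorem theorem1:
  fixes q n l :: nat and C :: "nat list multiset"
  assumes "q > 2" and "n \<ge> 1" and "[n = q] (mod q ^ 2)" and "l > 0"
    and "fold_one_packing l n q C"
  shows "(real (size C) \<le> real q ^ n * ((real n + 1) * real l - 1)
              / (real n ^ 2 * (real q - 1) + real n * real q)
          \<and> (real (size C) = real q ^ n * ((real n + 1) * real l - 1)
                / (real n ^ 2 * (real q - 1) + real n * real q)
             \<longrightarrow> no_multiple_codewords C))
       \<and> (even q \<and> even n \<and> even l \<longrightarrow>
          real (size C) \<le> real q ^ n * ((real n + 1) * (real q - 1) * real l - real q)
              / (real n * (real q - 1) * (real n * (real q - 1) + real q))
          \<and> (real (size C) = real q ^ n * ((real n + 1) * (real q - 1) * real l - real q)
                / (real n * (real q - 1) * (real n * (real q - 1) + real q))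
             \<longrightarrow> no_multiple_codewords C))"
proof -
  let ?V = "hamming_vertices n q"
  define f where "f v = int (count C v)" for v
  define L where "L = int l"
  let ?g = "slack n q L f"
  note q = \<open>q > 2\<close> and n = \<open>n \<ge> 1\<close> and l = \<open>l > 0\<close>
  have C: "set_mset C \<subseteq> ?V"
    and ball: "\<And>v. v \<in> ?V \<Longrightarrow> size {# c \<in># C. hamming_dist v c \<le> 1 #} \<le> l"
    using assms(5) by (auto simp: fold_one_packing_def)
  have "q dvd q ^ 2" by simp
  with assms(3) have "[n = q] (mod q)"
    by (rule cong_dvd_modulus_nat)
  then have dvd: "q dvd n"
    by (simp add: cong_dvd_iff)
  have f0: "f v \<ge> 0" for v by (simp add: f_def)
  have g0: "?g v \<ge> 0" if "v \<in> ?V" for v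
  proof -
    have "(\<Sum>w | w \<in> ?V \<and> hamming_dist v w \<le> 1. f w) \<le> L"
      using ball[OF that] size_filter_mset_eq_sum[OF C, of "\<lambda>c. hamming_dist v c \<le> 1"]
      by (simp add: f_def L_def flip: of_nat_sum)
    then show ?thesis
      using sum_ball_eq_line_sum[OF that, of f] by (simp add: slack_def)
  qed
  have Ag0: "line_sum q ?g v - int n * ?g v \<ge> 0" if "v \<in> ?V" for v
    using line_sum_nonneg_ge[OF that, of ?g] g0 by simp
  have W0: "slack_weight n q L f v \<ge> 0" if "v \<in> ?V" for v
    unfolding slack_weight_def using g0[OF that] Ag0[OF that] q by simp
  have F: "int (size C) = (\<Sum>v\<in>?V. f v)"
    using size_filter_mset_eq_sum[OF C, of "\<lambda>_. True"] by (simp add: f_def)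
  have nm: "no_multiple_codewords C" if "\<And>v. v \<in> ?V \<Longrightarrow> f v \<le> 1"
    unfolding no_multiple_codewords_def
  proof
    fix c assume "c \<in># C"
    then have "c \<in> ?V" "count C c \<noteq> 0"
      using C by (auto simp: count_eq_zero_iff)
    moreover from this have "count C c \<le> 1"
      using that[of c] by (simp add: f_def)
    ultimately show "count C c = 1"
      by linarith
  qed
  have pos: "real n * (real q - 1) * (real n * (real q - 1) + real q) > 0"
  proof -
    have "real n * (real q - 1) > 0"
      using n q by simp
    then show ?thesis
      using q by (simp add: add_pos_pos)
  qed
  \<comment> \<open>Both bounds have this shape. Besides excluding repeated codewords,
    \<open>c2\<close> keeps the numerator nonnegative when \<open>C\<close> is empty, since
    \<open>(n + 1) l \<ge> 2\<close>.\<close>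
  have general: "real (size C) \<le> real q ^ n * ((real n + 1) * (real q - 1) * real l - of_int c)
        / (real n * (real q - 1) * (real n * (real q - 1) + real q))
      \<and> (real (size C) = real q ^ n * ((real n + 1) * (real q - 1) * real l - of_int c)
        / (real n * (real q - 1) * (real n * (real q - 1) + real q)) \<longrightarrow> no_multiple_codewords C)"
    if c: "\<And>v. v \<in> ?V \<Longrightarrow> f v > 0 \<Longrightarrow> c \<le> (int q - 1) * f v + slack_weight n q L f v"
      and c2: "c < 2 * (int q - 1)" for c
  proof (cases "size C = 0")
    case True
    have "2 * (int q - 1) \<le> (int n + 1) * (int q - 1) * int l"
    proof -
      have "2 * (int q - 1) * 1 \<le> (int n + 1) * (int q - 1) * int l"
        using n q l by (intro mult_mono mult_right_mono) auto
      then show ?thesis by simp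
    qed
    with c2 have "real_of_int c \<le> of_int ((int n + 1) * (int q - 1) * int l)"
      unfolding of_int_le_iff by simp
    then have "0 \<le> (real n + 1) * (real q - 1) * real l - of_int c" by simp
    then show ?thesis
      using True pos by (auto simp: no_multiple_codewords_def intro!: divide_nonneg_pos)
  next
    case False
    let ?E = "int n * (int q - 1) * (int n * (int q - 1) + int q)"
    let ?R = "int q ^ n * (L * (int q - 1) * (int n + 1) - c)"
    have E: "real n * (real q - 1) * (real n * (real q - 1) + real q) = of_int ?E"
      by simp
    have R: "real q ^ n * ((real n + 1) * (real q - 1) * real l - of_int c) = of_int ?R"
      by (simp add: L_def algebra_simps)
    have S: "real (size C) = of_int (int (size C))" by simp
    have "q > 0" using q by simp
    note wb = weighted_bound[OF this dvd f0 W0 c F]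
    have "(?E * int (size C)) * int (size C) \<le> ?R * int (size C)"
      using wb(1) by (simp add: power2_eq_square mult.assoc)
    then have "?E * int (size C) \<le> ?R"
      using False by simp
    then have "real_of_int (int (size C)) * of_int ?E \<le> of_int ?R"
      unfolding of_int_mult[symmetric] of_int_le_iff by (simp only: mult.commute)
    moreover have "no_multiple_codewords C" if "real_of_int (int (size C)) * of_int ?E = of_int ?R"
    proof -
      from that have "int (size C) * ?E = ?R"
        unfolding of_int_mult[symmetric] of_int_eq_iff .
      then have "?E * int (size C) ^ 2 = ?R * int (size C)"
        by (metis mult.commute mult.assoc power2_eq_square)
      then show ?thesis
        by (intro nm wb(2)[OF _ _ _ _ c2])
    qed
    ultimately show ?thesis
      using pos unfolding E R S by (simp only: pos_le_divide_eq eq_divide_eq) auto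
  qed
  have "int q - 1 \<le> (int q - 1) * f v + slack_weight n q L f v" if "v \<in> ?V" "f v > 0" for v
  proof -
    have "(int q - 1) * 1 \<le> (int q - 1) * f v"
      using that q by (intro mult_left_mono) auto
    then show ?thesis using W0[OF that(1)] by simp
  qed
  from general[OF this] q
  have "real (size C) \<le> real q ^ n * ((real n + 1) * (real q - 1) * real l - (real q - 1))
        / (real n * (real q - 1) * (real n * (real q - 1) + real q))
      \<and> (real (size C) = real q ^ n * ((real n + 1) * (real q - 1) * real l - (real q - 1))
        / (real n * (real q - 1) * (real n * (real q - 1) + real q)) \<longrightarrow> no_multiple_codewords C)"
    by simp
  \<comment> \<open>For \<open>c = q - 1\<close> a factor \<open>q - 1\<close> cancels.\<close>
  moreover have "real q ^ n * ((real n + 1) * (real q - 1) * real l - (real q - 1))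
        / (real n * (real q - 1) * (real n * (real q - 1) + real q))
      = real q ^ n * ((real n + 1) * real l - 1) / (real n ^ 2 * (real q - 1) + real n * real q)"
  proof -
    have "real q ^ n * ((real n + 1) * (real q - 1) * real l - (real q - 1))
        = (real q - 1) * (real q ^ n * ((real n + 1) * real l - 1))"
      by (simp add: algebra_simps)
    moreover have "real n * (real q - 1) * (real n * (real q - 1) + real q)
        = (real q - 1) * (real n ^ 2 * (real q - 1) + real n * real q)"
      by (simp add: power2_eq_square algebra_simps)
    ultimately show ?thesis
      using q by (simp only: mult_divide_mult_cancel_left_if) auto
  qed
  moreover have "real (size C) \<le> real q ^ n * ((real n + 1) * (real q - 1) * real l - of_int (int q))
        / (real n * (real q - 1) * (real n * (real q - 1) + real q))
      \<and> (real (size C) = real q ^ n * ((real n + 1) * (real q - 1) * real l - of_int (int q))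
        / (real n * (real q - 1) * (real n * (real q - 1) + real q)) \<longrightarrow> no_multiple_codewords C)"
    if ev: "even q" "even n" "even l"
  proof (rule general)
    show "int q < 2 * (int q - 1)" using q by simp
    fix v assume v: "v \<in> ?V" and fv: "f v > 0"
    show "int q \<le> (int q - 1) * f v + slack_weight n q L f v"
    proof (cases "f v = 1")
      case True
      \<comment> \<open>As \<open>f v = 1\<close> is odd, the slack plus its neighbour sum is odd,
        hence at least 1; this raises the gain from \<open>q - 1\<close> to
        \<open>q\<close>.\<close>
      have even: "even (f v + ?g v + (line_sum q ?g v - int n * ?g v))"
        using ev v by (intro even_slack_parity) (auto simp: L_def hamming_vertices_def)
      have "?g v + (line_sum q ?g v - int n * ?g v) \<noteq> 0"
      proof
        assume "?g v + (line_sum q ?g v - int n * ?g v) = 0"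
        with True have "f v + ?g v + (line_sum q ?g v - int n * ?g v) = 1"
          by linarith
        with even show False by simp
      qed
      moreover have "?g v \<le> (int q - 1) * ?g v"
        using mult_right_mono[of 1 "int q - 1" "?g v"] g0[OF v] q by simp
      ultimately show ?thesis
        using g0[OF v] Ag0[OF v] True by (simp add: slack_weight_def)
    next
      case False
      \<comment> \<open>Multiplicity at least 2 contributes \<open>2 (q - 1) \<ge> q\<close> by
        itself.\<close>
      then have "(int q - 1) * 2 \<le> (int q - 1) * f v"
        using fv q by (intro mult_left_mono) auto
      then show ?thesis using W0[OF v] q by simp
    qed
  qed
  ultimately show ?thesis by simp
qed

end
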